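(* Let $G,H$ be graphs without isolated vertices and let $\phi,\psi:G\to H$ be homotopic graph morphisms. Then there is a natural isomorphism from $\phi_*$ to $\psi_*$, where $\phi_*,\psi_*:\Pi(G)\to\Pi(H)$ are the induced functors.
   Context: A graph is a finite undirected graph, loops allowed, at most one edge between two vertices; a graph morphism is a vertex map preserving edges; a vertex is isolated if it has no neighbors. The exponential graph $H^G$ has as vertices the set maps $V(G)\to V(H)$, with $f\text{---}g$ iff $f(v_1)\text{---}g(v_2)$ for every edge $v_1\text{---}v_2$ of $G$; morphisms $\phi,\psi$ are homotopic if joined by a sequence of morphisms consecutive ones adjacent in $H^G$. A walk of length $n$ from $x$ to $y$ is a sequence $(v_0\dots v_n)$ with $v_0=x$, $v_n=y$, $v_i\text{---}v_{i+1}$. Walks $\gamma,\gamma'$ of length $n$ are adjacent if $\gamma(i)\text{---}\gamma'(i+1)$ and $\gamma(i+1)\text{---}\gamma'(i)$ for all $i$; walks of length $n$ from $x$ to $y$ are homotopic rel endpoints if joined by a sequence of such walks with consecutive ones adjacent. $\Pi(G)$ is the groupoid with objects $V(G)$ and arrows the classes of walks under the equivalence generated by homotopy rel endpoints and $(v_0\dots v_{n-1}v_n)\sim(v_0\dots v_{n-1}v_nv_{n-1}v_n)$, composed by concatenation. A morphism $\phi:G\to H$ induces the functor $\phi_*:\Pi(G)\to\Pi(H)$, $v\mapsto\phi(v)$, $[(v_0\dots v_n)]\mapsto[(\phi(v_0)\dots\phi(v_n))]$. *)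

theory Defs
  imports Main "HOL-Library.FuncSet"
begin

section \<open>Graphs, morphisms and homotopy of morphisms\<close>

text \<open>An undirected edge between \<open>u\<close> and \<open>v\<close> is encoded by having both \<open>(u, v)\<close> and
  \<open>(v, u)\<close> in the symmetric relation \<open>edges G\<close>; a loop at \<open>v\<close> is the pair \<open>(v, v)\<close>.\<close>

record 'a pre_graph =
  verts :: "'a set"
  edges :: "('a \<times> 'a) set"

locale graph =
  fixes G :: "'a pre_graph"
  assumes finite_verts: "finite (verts G)"
    and edges_subset: "edges G \<subseteq> verts G \<times> verts G"
    and sym_edges: "sym (edges G)"

text \<open>A looped vertex is a neighbour of itself, hence not isolated.\<close>

definition isolated :: "'a pre_graph \<Rightarrow> 'a \<Rightarrow> bool" where
  "isolated G v \<longleftrightarrow> v \<in> verts G \<and> (\<nexists>w. (v, w) \<in> edges G)"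

text \<open>Set maps \<open>V(G) \<rightarrow> V(H)\<close> are represented by extensional functions, so that two of them
  are equal as HOL functions iff they agree on \<open>V(G)\<close>, and \<open>H\<^sup>G\<close> is again a finite graph.\<close>

definition graph_hom :: "'a pre_graph \<Rightarrow> 'b pre_graph \<Rightarrow> ('a \<Rightarrow> 'b) set" where
  "graph_hom G H =
     {f \<in> verts G \<rightarrow>\<^sub>E verts H. \<forall>(u, v) \<in> edges G. (f u, f v) \<in> edges H}"

definition exp_graph :: "'b pre_graph \<Rightarrow> 'a pre_graph \<Rightarrow> ('a \<Rightarrow> 'b) pre_graph" where
  "exp_graph H G =
     \<lparr>verts = verts G \<rightarrow>\<^sub>E verts H,
      edges = {(f, g). f \<in> verts G \<rightarrow>\<^sub>E verts H \<and> g \<in> verts G \<rightarrow>\<^sub>E verts H \<and>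
                       (\<forall>(u, v) \<in> edges G. (f u, g v) \<in> edges H)}\<rparr>"

definition homotopic :: "'a pre_graph \<Rightarrow> 'b pre_graph \<Rightarrow> ('a \<Rightarrow> 'b) \<Rightarrow> ('a \<Rightarrow> 'b) \<Rightarrow> bool" where
  "homotopic G H \<phi> \<psi> \<longleftrightarrow>
     \<phi> \<in> graph_hom G H \<and> \<psi> \<in> graph_hom G H \<and>
     (\<lambda>f g. f \<in> graph_hom G H \<and> g \<in> graph_hom G H \<and> (f, g) \<in> edges (exp_graph H G))\<^sup>*\<^sup>* \<phi> \<psi>"

section \<open>Walks\<close>

text \<open>The walk \<open>(v\<^sub>0 \<dots> v\<^sub>n)\<close> of length \<open>n\<close> is the list of its \<open>n + 1\<close> vertices.\<close>

definition walk :: "'a pre_graph \<Rightarrow> 'a list \<Rightarrow> bool" where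
  "walk G \<gamma> \<longleftrightarrow> \<gamma> \<noteq> [] \<and> set \<gamma> \<subseteq> verts G \<and>
     (\<forall>i. Suc i < length \<gamma> \<longrightarrow> (\<gamma> ! i, \<gamma> ! Suc i) \<in> edges G)"

definition walks_between :: "'a pre_graph \<Rightarrow> 'a \<Rightarrow> 'a \<Rightarrow> 'a list set" where
  "walks_between G x y = {\<gamma>. walk G \<gamma> \<and> hd \<gamma> = x \<and> last \<gamma> = y}"

definition walk_adj :: "'a pre_graph \<Rightarrow> 'a list \<Rightarrow> 'a list \<Rightarrow> bool" where
  "walk_adj G \<gamma> \<gamma>' \<longleftrightarrow> length \<gamma> = length \<gamma>' \<and>
     (\<forall>i. Suc i < length \<gamma> \<longrightarrow>
        (\<gamma> ! i, \<gamma>' ! Suc i) \<in> edges G \<and> (\<gamma> ! Suc i, \<gamma>' ! i) \<in> edges G)"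

definition homotopic_rel_endpoints ::
    "'a pre_graph \<Rightarrow> 'a \<Rightarrow> 'a \<Rightarrow> 'a list \<Rightarrow> 'a list \<Rightarrow> bool" where
  "homotopic_rel_endpoints G x y \<gamma> \<gamma>' \<longleftrightarrow>
     \<gamma> \<in> walks_between G x y \<and> \<gamma>' \<in> walks_between G x y \<and>
     (\<lambda>\<alpha> \<beta>. \<alpha> \<in> walks_between G x y \<and> \<beta> \<in> walks_between G x y \<and> walk_adj G \<alpha> \<beta>)\<^sup>*\<^sup>* \<gamma> \<gamma>'"

text \<open>The relation \<open>(v\<^sub>0 \<dots> v\<^sub>n\<^sub>-\<^sub>1 v\<^sub>n) \<sim> (v\<^sub>0 \<dots> v\<^sub>n\<^sub>-\<^sub>1 v\<^sub>n v\<^sub>n\<^sub>-\<^sub>1 v\<^sub>n)\<close> needs \<open>n \<ge> 1\<close>. For the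
  walk \<open>(v)\<close> of length 0 it is read as \<open>(v) \<sim> (v w v)\<close> for the neighbours \<open>w\<close> of \<open>v\<close>:
  the class of \<open>(v)\<close> is the identity at \<open>v\<close>, and \<open>(v w v)\<close> is the concatenation of \<open>(v w)\<close>
  with its inverse \<open>(w v)\<close>.\<close>

inductive walk_extend :: "'a pre_graph \<Rightarrow> 'a list \<Rightarrow> 'a list \<Rightarrow> bool" for G where
  extend: "walk G (\<gamma> @ [u, v]) \<Longrightarrow> walk_extend G (\<gamma> @ [u, v]) (\<gamma> @ [u, v, u, v])"
| extend_trivial: "walk G [v] \<Longrightarrow> (v, w) \<in> edges G \<Longrightarrow> walk_extend G [v] [v, w, v]"

definition walk_equiv :: "'a pre_graph \<Rightarrow> ('a list \<times> 'a list) set" where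
  "walk_equiv G = {(\<gamma>, \<gamma>'). walk G \<gamma> \<and> walk G \<gamma>' \<and>
     equivclp (\<lambda>\<alpha> \<beta>. (\<exists>x y. homotopic_rel_endpoints G x y \<alpha> \<beta>) \<or> walk_extend G \<alpha> \<beta>) \<gamma> \<gamma>'}"

section \<open>Categories, functors and natural isomorphisms\<close>

text \<open>\<open>Comp C g f\<close> is \<open>f\<close> followed by \<open>g\<close>.\<close>

record ('o, 'm) pre_category =
  Obj :: "'o set"
  Hom :: "'o \<Rightarrow> 'o \<Rightarrow> 'm set"
  Id :: "'o \<Rightarrow> 'm"
  Comp :: "'m \<Rightarrow> 'm \<Rightarrow> 'm"

locale category =
  fixes C :: "('o, 'm) pre_category"
  assumes Hom_disjoint:
      "\<lbrakk>x \<in> Obj C; y \<in> Obj C; x' \<in> Obj C; y' \<in> Obj C; f \<in> Hom C x y; f \<in> Hom C x' y'\<rbrakk>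
       \<Longrightarrow> x = x' \<and> y = y'"
    and Id_in_Hom: "x \<in> Obj C \<Longrightarrow> Id C x \<in> Hom C x x"
    and Comp_in_Hom:
      "\<lbrakk>x \<in> Obj C; y \<in> Obj C; z \<in> Obj C; f \<in> Hom C x y; g \<in> Hom C y z\<rbrakk>
       \<Longrightarrow> Comp C g f \<in> Hom C x z"
    and Comp_Id_right:
      "\<lbrakk>x \<in> Obj C; y \<in> Obj C; f \<in> Hom C x y\<rbrakk> \<Longrightarrow> Comp C f (Id C x) = f"
    and Comp_Id_left:
      "\<lbrakk>x \<in> Obj C; y \<in> Obj C; f \<in> Hom C x y\<rbrakk> \<Longrightarrow> Comp C (Id C y) f = f"
    and Comp_assoc:
      "\<lbrakk>w \<in> Obj C; x \<in> Obj C; y \<in> Obj C; z \<in> Obj C;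
        f \<in> Hom C w x; g \<in> Hom C x y; h \<in> Hom C y z\<rbrakk>
       \<Longrightarrow> Comp C (Comp C h g) f = Comp C h (Comp C g f)"

definition isomorphism :: "('o, 'm) pre_category \<Rightarrow> 'o \<Rightarrow> 'o \<Rightarrow> 'm \<Rightarrow> bool" where
  "isomorphism C x y f \<longleftrightarrow>
     f \<in> Hom C x y \<and> (\<exists>g \<in> Hom C y x. Comp C g f = Id C x \<and> Comp C f g = Id C y)"

record ('o, 'm, 'p, 'n) pre_functor =
  on_obj :: "'o \<Rightarrow> 'p"
  on_arr :: "'m \<Rightarrow> 'n"

locale category_functor = C: category C + D: category D
  for C :: "('o, 'm) pre_category" and D :: "('p, 'n) pre_category" +
  fixes F :: "('o, 'm, 'p, 'n) pre_functor"
  assumes on_obj_in_Obj: "x \<in> Obj C \<Longrightarrow> on_obj F x \<in> Obj D"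
    and on_arr_in_Hom:
      "\<lbrakk>x \<in> Obj C; y \<in> Obj C; f \<in> Hom C x y\<rbrakk>
       \<Longrightarrow> on_arr F f \<in> Hom D (on_obj F x) (on_obj F y)"
    and on_arr_Id: "x \<in> Obj C \<Longrightarrow> on_arr F (Id C x) = Id D (on_obj F x)"
    and on_arr_Comp:
      "\<lbrakk>x \<in> Obj C; y \<in> Obj C; z \<in> Obj C; f \<in> Hom C x y; g \<in> Hom C y z\<rbrakk>
       \<Longrightarrow> on_arr F (Comp C g f) = Comp D (on_arr F g) (on_arr F f)"

locale natural_transformation = F: category_functor C D F + F': category_functor C D F'
  for C :: "('o, 'm) pre_category" and D :: "('p, 'n) pre_category"
    and F F' :: "('o, 'm, 'p, 'n) pre_functor" +
  fixes \<eta> :: "'o \<Rightarrow> 'n"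
  assumes component_in_Hom:
      "x \<in> Obj C \<Longrightarrow> \<eta> x \<in> Hom D (on_obj F x) (on_obj F' x)"
    and naturality:
      "\<lbrakk>x \<in> Obj C; y \<in> Obj C; f \<in> Hom C x y\<rbrakk>
       \<Longrightarrow> Comp D (\<eta> y) (on_arr F f) = Comp D (on_arr F' f) (\<eta> x)"

locale natural_isomorphism = natural_transformation +
  assumes component_iso: "x \<in> Obj C \<Longrightarrow> isomorphism D (on_obj F x) (on_obj F' x) (\<eta> x)"

section \<open>The fundamental groupoid and the induced functors\<close>

text \<open>In both definitions below the operation on classes is the union of the classes obtained
  from all representatives. It is a single class exactly when the operation on walks respects
  \<open>walk_equiv\<close>; this is part of the \<open>category\<close> and \<open>category_functor\<close> axioms. As
  consecutive walks share a vertex, the concatenation of \<open>\<alpha>\<close> and \<open>\<beta>\<close> is \<open>\<alpha> @ tl \<beta>\<close>.\<close>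

definition fundamental_groupoid :: "'a pre_graph \<Rightarrow> ('a, 'a list set) pre_category" where
  "fundamental_groupoid G =
     \<lparr>Obj = verts G,
      Hom = (\<lambda>x y. walks_between G x y // walk_equiv G),
      Id = (\<lambda>x. walk_equiv G `` {[x]}),
      Comp = (\<lambda>b a. \<Union>\<alpha>\<in>a. \<Union>\<beta>\<in>b. walk_equiv G `` {\<alpha> @ tl \<beta>})\<rparr>"

definition induced_functor ::
    "'b pre_graph \<Rightarrow> ('a \<Rightarrow> 'b) \<Rightarrow> ('a, 'a list set, 'b, 'b list set) pre_functor" where
  "induced_functor H \<phi> =
     \<lparr>on_obj = \<phi>, on_arr = (\<lambda>a. \<Union>\<gamma>\<in>a. walk_equiv H `` {map \<phi> \<gamma>})\<rparr>"

end

theory Submission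
  imports Defs
begin

text \<open>Replacing an interior vertex of a walk is a homotopy rel endpoints, so a backtrack
  \<open>v w v\<close> can be slid along a walk to its end and deleted there; hence it can be deleted anywhere
  and concatenation respects the equivalence of walks. If \<open>\<phi>\<close> and \<open>\<psi>\<close> are adjacent in the
  exponential graph and \<open>w\<close> is any neighbour of \<open>x\<close>, then \<open>(\<phi> x, \<phi> w, \<psi> x)\<close> is a walk.
  Along an edge \<open>(x, y)\<close>, with \<open>z\<close> a neighbour of \<open>y\<close>, two such replacements give the
  naturality square:
  \<open>(\<phi> x, \<phi> w, \<psi> x, \<psi> y) \<sim> (\<phi> x, \<phi> y, \<psi> x, \<psi> y) \<sim> (\<phi> x, \<phi> y, \<phi> z, \<psi> y)\<close>.
  A sequence of adjacent morphisms is handled by concatenating these walks.\<close>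

section \<open>Equivalence of walks\<close>

lemma walk_altdef:
  "walk G \<gamma> \<longleftrightarrow> \<gamma> \<noteq> [] \<and> set \<gamma> \<subseteq> verts G \<and> successively (\<lambda>u v. (u, v) \<in> edges G) \<gamma>"
  by (auto simp: walk_def successively_conv_nth)

lemma walk_singleton: "walk G [v] \<longleftrightarrow> v \<in> verts G"
  by (simp add: walk_altdef)

lemma walk_nonempty: "walk G \<gamma> \<Longrightarrow> \<gamma> \<noteq> []"
  by (simp add: walk_def)

lemma walk_append:
  assumes "xs \<noteq> []" "ys \<noteq> []"
  shows "walk G (xs @ ys) \<longleftrightarrow> walk G xs \<and> walk G ys \<and> (last xs, hd ys) \<in> edges G"
  using assms by (auto simp: walk_altdef successively_append_iff)

lemma walk_Cons:
  assumes "ys \<noteq> []"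
  shows "walk G (x # ys) \<longleftrightarrow> x \<in> verts G \<and> walk G ys \<and> (x, hd ys) \<in> edges G"
  using walk_append[of "[x]" ys G] assms by (simp add: walk_singleton)

lemma walk_infix: "walk G (xs @ \<alpha> @ ys) \<Longrightarrow> \<alpha> \<noteq> [] \<Longrightarrow> walk G \<alpha>"
  by (auto simp: walk_altdef successively_append_iff)

lemma walk_concat:
  assumes "walk G \<alpha>" "walk G \<beta>" "last \<alpha> = hd \<beta>"
  shows "walk G (\<alpha> @ tl \<beta>)"
  using assms walk_nonempty[OF assms(1)]
  by (cases \<beta>; cases "tl \<beta>") (auto simp: walk_append walk_Cons dest: walk_nonempty)

lemma hd_last_concat:
  assumes "\<alpha> \<noteq> []" "\<beta> \<noteq> []" "last \<alpha> = hd \<beta>"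
  shows "hd (\<alpha> @ tl \<beta>) = hd \<alpha>" "last (\<alpha> @ tl \<beta>) = last \<beta>"
  using assms by (cases \<beta>; auto)+

lemma butlast_append_concat:
  assumes "\<alpha> \<noteq> []" "\<beta> \<noteq> []" "last \<alpha> = hd \<beta>"
  shows "\<alpha> @ tl \<beta> = butlast \<alpha> @ \<beta>"
  using assms by (cases \<alpha> rule: rev_cases; cases \<beta>) auto

text \<open>The surroundings meet the middle part only in its two end vertices, so no junction edge
  changes.\<close>

lemma walk_replace_middle:
  assumes "walk G (xs @ \<alpha> @ ys)" "walk G \<alpha>" "walk G \<alpha>'" "hd \<alpha> = hd \<alpha>'" "last \<alpha> = last \<alpha>'"
  shows "walk G (xs @ \<alpha>' @ ys)"
proof -
  have "\<alpha> \<noteq> []" "\<alpha>' \<noteq> []" using assms by (auto simp: walk_def)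
  then show ?thesis using assms
    by (cases "xs = []"; cases "ys = []") (auto simp: walk_append)
qed

section \<open>Adjacency of walks inside a longer walk\<close>

lemma walk_adj_Cons:
  assumes "walk_adj G \<alpha> \<alpha>'" "walk G (x # \<alpha>)" "hd \<alpha> = hd \<alpha>'" "\<alpha> \<noteq> []"
    and "sym (edges G)"
  shows "walk_adj G (x # \<alpha>) (x # \<alpha>')"
proof -
  have e: "(x, hd \<alpha>) \<in> edges G" "(hd \<alpha>, x) \<in> edges G"
    using assms by (auto simp: walk_Cons symD)
  have "\<alpha>' \<noteq> []" using assms by (auto simp: walk_adj_def)
  then show ?thesis
    using assms e unfolding walk_adj_def
    by (auto simp: nth_Cons hd_conv_nth split: nat.split)
qed

lemma walk_adj_snoc:
  assumes "walk_adj G \<alpha> \<alpha>'" "walk G (\<alpha> @ [y])" "last \<alpha> = last \<alpha>'" "\<alpha> \<noteq> []"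
    and "sym (edges G)"
  shows "walk_adj G (\<alpha> @ [y]) (\<alpha>' @ [y])"
proof -
  have e: "(last \<alpha>, y) \<in> edges G" "(y, last \<alpha>) \<in> edges G"
    using assms by (auto simp: walk_append symD)
  have len: "length \<alpha>' = length \<alpha>" and ne: "\<alpha>' \<noteq> []" using assms by (auto simp: walk_adj_def)
  have l: "last \<alpha> = \<alpha> ! (length \<alpha> - 1)" "last \<alpha> = \<alpha>' ! (length \<alpha> - 1)"
    using assms ne len by (simp_all add: last_conv_nth)
  show ?thesis unfolding walk_adj_def
  proof (rule conjI, use len in simp, intro allI impI)
    fix i assume i: "Suc i < length (\<alpha> @ [y])"
    show "((\<alpha> @ [y]) ! i, (\<alpha>' @ [y]) ! Suc i) \<in> edges G \<and>
      ((\<alpha> @ [y]) ! Suc i, (\<alpha>' @ [y]) ! i) \<in> edges G"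
    \<comment> \<open>Only the index \<open>i = length \<alpha> - 1\<close> is new. There both walks
      stand at \<open>last \<alpha>\<close>, so the two crossing conditions reduce to the edge from
      \<open>last \<alpha>\<close> to \<open>y\<close> in its two directions.\<close>
    proof (cases "Suc i < length \<alpha>")
      case True
      then show ?thesis using assms(1) len by (simp add: walk_adj_def nth_append)
    next
      case False
      then have "i = length \<alpha> - 1" "Suc i = length \<alpha>" "i < length \<alpha>" using i by auto
      then show ?thesis using e l len by (simp add: nth_append)
    qed
  qed
qed

context graph
begin

lemma edge_sym: "(u, v) \<in> edges G \<Longrightarrow> (v, u) \<in> edges G"
  using sym_edges by (rule symD)

lemma walk_rev:
  assumes "walk G \<alpha>"
  shows "walk G (rev \<alpha>)"
proof -
  have "successively (\<lambda>u v. (v, u) \<in> edges G) \<alpha>"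
    using assms by (auto simp: walk_altdef successively_conv_nth intro: edge_sym)
  then show ?thesis
    using assms by (simp add: walk_altdef)
qed

lemma edge_verts: "(u, v) \<in> edges G \<Longrightarrow> u \<in> verts G \<and> v \<in> verts G"
  using edges_subset by auto

text \<open>The context is added one vertex at a time, first on the right and then on the left.
  Equal ends of \<alpha> and \<alpha>' make each new crossing condition an edge of the given
  walk.\<close>

lemma walk_adj_append:
  assumes "walk_adj G \<alpha> \<alpha>'" "walk G (xs @ \<alpha> @ ys)" "hd \<alpha> = hd \<alpha>'" "last \<alpha> = last \<alpha>'" "\<alpha> \<noteq> []"
  shows "walk_adj G (xs @ \<alpha> @ ys) (xs @ \<alpha>' @ ys)"
proof -
  have ne: "\<alpha>' \<noteq> []" using assms by (auto simp: walk_adj_def)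
  have right: "walk_adj G (\<alpha> @ ys) (\<alpha>' @ ys)" if "walk G (\<alpha> @ ys)" using that
  proof (induction ys rule: rev_induct)
    case (snoc y ys)
    then have "walk G (\<alpha> @ ys)" using assms walk_infix[of G "[]" "\<alpha> @ ys" "[y]"] by simp
    with snoc have "walk_adj G (\<alpha> @ ys) (\<alpha>' @ ys)" by blast
    then have "walk_adj G ((\<alpha> @ ys) @ [y]) ((\<alpha>' @ ys) @ [y])"
      by (rule walk_adj_snoc) (use snoc assms ne sym_edges in \<open>auto simp: last_append\<close>)
    then show ?case by simp
  qed (use assms in simp)
  show ?thesis using assms(2)
  proof (induction xs)
    case (Cons x xs)
    then have "walk G (xs @ \<alpha> @ ys)" using assms by (simp add: walk_Cons)
    with Cons have "walk_adj G (xs @ \<alpha> @ ys) (xs @ \<alpha>' @ ys)" by blast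
    then have "walk_adj G (x # (xs @ \<alpha> @ ys)) (x # (xs @ \<alpha>' @ ys))"
      by (rule walk_adj_Cons) (use Cons assms ne sym_edges in \<open>auto simp: hd_append\<close>)
    then show ?case by simp
  qed (use right in simp)
qed

lemma walk_extend_walk: "walk_extend G \<alpha> \<beta> \<Longrightarrow> walk G \<alpha> \<and> walk G \<beta>"
proof (induction rule: walk_extend.induct)
  case (extend \<gamma> u v)
  have "walk G [u, v]" using extend by (cases "\<gamma> = []") (auto simp: walk_append)
  with extend show ?case
    by (cases "\<gamma> = []") (auto simp: walk_append walk_Cons edge_sym dest: edge_verts)
next
  case (extend_trivial v w)
  then show ?case using edge_verts by (auto simp: walk_Cons walk_singleton edge_sym)
qed

section \<open>The equivalence relation on walks\<close>

lemma equiv_walk_equiv: "equiv {\<gamma>. walk G \<gamma>} (walk_equiv G)"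
  by (rule equivI)
    (auto simp: walk_equiv_def refl_on_def sym_def trans_def
       intro: equivclp_sym equivclp_trans)

lemma walk_equiv_refl: "walk G \<alpha> \<Longrightarrow> (\<alpha>, \<alpha>) \<in> walk_equiv G"
  by (simp add: walk_equiv_def)

lemma walk_equiv_sym: "(\<alpha>, \<beta>) \<in> walk_equiv G \<Longrightarrow> (\<beta>, \<alpha>) \<in> walk_equiv G"
  by (auto simp: walk_equiv_def intro: equivclp_sym)

lemma walk_equiv_trans [trans]:
  "(\<alpha>, \<beta>) \<in> walk_equiv G \<Longrightarrow> (\<beta>, \<gamma>) \<in> walk_equiv G \<Longrightarrow> (\<alpha>, \<gamma>) \<in> walk_equiv G"
  by (auto simp: walk_equiv_def intro: equivclp_trans)

lemma walk_equiv_walk: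
  "(\<alpha>, \<beta>) \<in> walk_equiv G \<Longrightarrow> walk G \<alpha>" "(\<alpha>, \<beta>) \<in> walk_equiv G \<Longrightarrow> walk G \<beta>"
  by (auto simp: walk_equiv_def)

lemma walk_equiv_adj:
  assumes "walk_adj G \<alpha> \<beta>" "walk G \<alpha>" "walk G \<beta>" "hd \<alpha> = hd \<beta>" "last \<alpha> = last \<beta>"
  shows "(\<alpha>, \<beta>) \<in> walk_equiv G"
proof -
  have "homotopic_rel_endpoints G (hd \<alpha>) (last \<alpha>) \<alpha> \<beta>"
    unfolding homotopic_rel_endpoints_def walks_between_def using assms by auto
  then show ?thesis using assms unfolding walk_equiv_def by (auto intro!: r_into_equivclp)
qed

lemma walk_equiv_extend: "walk_extend G \<alpha> \<beta> \<Longrightarrow> (\<alpha>, \<beta>) \<in> walk_equiv G"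
  using walk_extend_walk[of \<alpha> \<beta>] unfolding walk_equiv_def by (auto intro!: r_into_equivclp)

section \<open>Changing an interior vertex and deleting backtracks\<close>

lemma walk_equiv_replace_vertex:
  assumes "walk G (xs @ [u, v, w] @ ys)" "(u, v') \<in> edges G" "(v', w) \<in> edges G"
  shows "(xs @ [u, v, w] @ ys, xs @ [u, v', w] @ ys) \<in> walk_equiv G"
proof -
  have w: "walk G [u, v, w]"
    by (rule walk_infix[OF assms(1)]) simp
  have w': "walk G [u, v', w]"
    using assms(2,3) edge_verts by (auto simp: walk_Cons walk_singleton)
  \<comment> \<open>The crossing pairs are exactly the edges joining \<open>u\<close> and
    \<open>w\<close> to \<open>v\<close> and to \<open>v'\<close>.\<close>
  have "walk_adj G [u, v, w] [u, v', w]"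
    using w w' unfolding walk_adj_def
    by (auto simp: walk_Cons less_Suc_eq nth_Cons edge_sym)
  then have "walk_adj G (xs @ [u, v, w] @ ys) (xs @ [u, v', w] @ ys)"
    by (rule walk_adj_append) (use assms in auto)
  then show ?thesis
    by (rule walk_equiv_adj)
      (use assms(1) walk_replace_middle[OF assms(1) w w'] in \<open>auto simp: hd_append last_append\<close>)
qed

text \<open>Induction on the part after the backtrack. The prefix, the turning vertex and the
  neighbour all vary, since each slide moves the backtrack to the next vertex of the walk.\<close>

lemma walk_equiv_backtrack:
  assumes "walk G (xs @ [v] @ ys)" "(v, w) \<in> edges G"
  shows "(xs @ [v, w, v] @ ys, xs @ [v] @ ys) \<in> walk_equiv G"
  using assms
proof (induction ys arbitrary: xs v w)
  case Nil
  have vw: "walk G [v, w, v]" "walk G [v]"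
    using Nil.prems edge_verts edge_sym by (auto simp: walk_Cons walk_singleton)
  show ?case
  proof (cases xs rule: rev_cases)
    case Nil
    then show ?thesis
      using walk_equiv_sym[OF walk_equiv_extend[OF extend_trivial[OF vw(2) \<open>(v, w) \<in> edges G\<close>]]]
      by simp
  next
    case (snoc zs u)
    have uv: "(u, v) \<in> edges G" using Nil.prems snoc by (simp add: walk_append[of "zs @ [u]" "[v]", simplified])
    \<comment> \<open>Turned towards the predecessor \<open>u\<close> of \<open>v\<close>, the final
      backtrack reads \<open>u v u v\<close>, which is the extension of \<open>u v\<close>.\<close>
    have "walk G (zs @ [u, v, w] @ [v])"
      using walk_replace_middle[OF Nil.prems(1) vw(2,1)] snoc by simp
    then have "(zs @ [u, v, w] @ [v], (zs @ [u]) @ [v, u, v] @ []) \<in> walk_equiv G"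
      using walk_equiv_replace_vertex[of "zs @ [u]" v w v "[]" u] uv edge_sym by simp
    also have "((zs @ [u]) @ [v, u, v] @ [], zs @ [u, v]) \<in> walk_equiv G"
      using walk_equiv_sym[OF walk_equiv_extend[OF extend[of G zs u v]]] Nil.prems snoc by simp
    finally show ?thesis using snoc by simp
  qed
next
  case (Cons y ys)
  have vy: "(v, y) \<in> edges G" and vw: "walk G [v, w, v]" "walk G [v]"
    using Cons.prems edge_verts edge_sym walk_append[of "xs @ [v]" "y # ys" G]
    by (auto simp: walk_Cons walk_singleton)
  \<comment> \<open>Turned towards the next vertex \<open>y\<close>, the backtrack reads
    \<open>v y v y\<close>. This is also a backtrack at \<open>y\<close> with prefix
    \<open>xs @ [v]\<close>, to which the induction hypothesis applies.\<close>
  have "walk G (xs @ [v, w, v] @ y # ys)"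
    using walk_replace_middle[OF Cons.prems(1) vw(2,1)] by simp
  then have "(xs @ [v, w, v] @ y # ys, xs @ [v, y, v] @ y # ys) \<in> walk_equiv G"
    using vy edge_sym walk_equiv_replace_vertex[of xs v w v "y # ys" y] by simp
  also have "(xs @ [v, y, v] @ y # ys, xs @ [v] @ y # ys) \<in> walk_equiv G"
    using Cons.IH[of "xs @ [v]" y v] Cons.prems vy edge_sym by simp
  finally show ?case .
qed

section \<open>Compatibility of the equivalence with concatenation and reversal\<close>

text \<open>Equivalence inside every context: a strengthening of \<open>walk_equiv\<close> that can
  be checked on generators. The disjunct \<open>\<alpha> = \<beta>\<close> makes it reflexive on all
  lists, as the base cases of inductions along chains require.\<close>

definition replaceable :: "'a list \<Rightarrow> 'a list \<Rightarrow> bool" where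
  "replaceable \<alpha> \<beta> \<longleftrightarrow> \<alpha> = \<beta> \<or> walk G \<alpha> \<and> walk G \<beta> \<and> hd \<alpha> = hd \<beta> \<and> last \<alpha> = last \<beta> \<and>
     (\<forall>xs ys. walk G (xs @ \<alpha> @ ys) \<longrightarrow> (xs @ \<alpha> @ ys, xs @ \<beta> @ ys) \<in> walk_equiv G)"

text \<open>The clauses on equal ends serve here: they turn a context that is a walk around \<beta>
  into one that is a walk around \<alpha>.\<close>

lemma replaceable_sym: "replaceable \<alpha> \<beta> \<Longrightarrow> replaceable \<beta> \<alpha>"
  unfolding replaceable_def by (metis walk_equiv_sym walk_replace_middle)

lemma replaceable_trans: "replaceable \<alpha> \<beta> \<Longrightarrow> replaceable \<beta> \<gamma> \<Longrightarrow> replaceable \<alpha> \<gamma>"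
  unfolding replaceable_def by (metis walk_equiv_trans walk_equiv_walk(2))

lemma replaceable_adj:
  assumes "walk_adj G \<alpha> \<beta>" "\<alpha> \<in> walks_between G x y" "\<beta> \<in> walks_between G x y"
  shows "replaceable \<alpha> \<beta>"
proof -
  have *: "walk G \<alpha>" "walk G \<beta>" "hd \<alpha> = hd \<beta>" "last \<alpha> = last \<beta>" "\<alpha> \<noteq> []" "\<beta> \<noteq> []"
    using assms by (auto simp: walks_between_def walk_def)
  have "(xs @ \<alpha> @ ys, xs @ \<beta> @ ys) \<in> walk_equiv G" if "walk G (xs @ \<alpha> @ ys)" for xs ys
    using walk_adj_append[OF assms(1) that *(3,4,5)] that walk_replace_middle[OF that *(1-4)] *
    by (intro walk_equiv_adj) (auto simp: hd_append last_append)
  then show ?thesis using * unfolding replaceable_def by blast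
qed

lemma replaceable_extend:
  assumes "walk_extend G \<alpha> \<beta>"
  shows "replaceable \<alpha> \<beta>"
  using assms walk_extend_walk[OF assms]
proof (induction rule: walk_extend.induct)
  case (extend \<gamma> u v)
  have vu: "(v, u) \<in> edges G"
    using extend walk_append[of "\<gamma> @ [u]" "[v]" G] edge_sym by simp
  have "(xs @ (\<gamma> @ [u, v]) @ ys, xs @ (\<gamma> @ [u, v, u, v]) @ ys) \<in> walk_equiv G"
    if "walk G (xs @ (\<gamma> @ [u, v]) @ ys)" for xs ys
    \<comment> \<open>The extension inserts the backtrack \<open>v u v\<close> after
      \<open>xs @ \<gamma> @ [u]\<close>, now possibly in the interior of the walk.\<close>
    using walk_equiv_sym[OF walk_equiv_backtrack[of "xs @ \<gamma> @ [u]" v ys u]] that vu by simp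
  then show ?case using extend unfolding replaceable_def by (auto simp: hd_append)
next
  case (extend_trivial v w)
  have "(xs @ [v] @ ys, xs @ [v, w, v] @ ys) \<in> walk_equiv G" if "walk G (xs @ [v] @ ys)" for xs ys
    using walk_equiv_sym[OF walk_equiv_backtrack[OF that extend_trivial(2)]] .
  then show ?case using extend_trivial unfolding replaceable_def by auto
qed

text \<open>\<open>replaceable\<close> contains both generating relations and is itself reflexive,
  symmetric and transitive, so it contains the equivalence they generate.\<close>

lemma walk_equiv_replaceable:
  assumes "(\<alpha>, \<beta>) \<in> walk_equiv G"
  shows "replaceable \<alpha> \<beta>"
proof -
  have step: "replaceable \<alpha> \<beta>"
    if "(\<exists>x y. homotopic_rel_endpoints G x y \<alpha> \<beta>) \<or> walk_extend G \<alpha> \<beta>" for \<alpha> \<beta>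
    using that
  proof
    assume "\<exists>x y. homotopic_rel_endpoints G x y \<alpha> \<beta>"
    then obtain x y where "(\<lambda>\<alpha> \<beta>. \<alpha> \<in> walks_between G x y \<and> \<beta> \<in> walks_between G x y \<and>
        walk_adj G \<alpha> \<beta>)\<^sup>*\<^sup>* \<alpha> \<beta>"
      unfolding homotopic_rel_endpoints_def by blast
    then show ?thesis
    proof induction
      case base
      show ?case by (simp add: replaceable_def)
    qed (blast intro: replaceable_trans replaceable_adj)
  qed (rule replaceable_extend)
  have "equivclp (\<lambda>\<alpha> \<beta>. (\<exists>x y. homotopic_rel_endpoints G x y \<alpha> \<beta>) \<or> walk_extend G \<alpha> \<beta>) \<alpha> \<beta>"
    using assms by (simp add: walk_equiv_def)
  then show ?thesis
  proof (induction rule: equivclp_induct)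
    case base
    show ?case by (simp add: replaceable_def)
  next
    case (step y z)
    \<comment> \<open>A link of the chain may be a generator in either direction; symmetry covers
      the reversed one.\<close>
    then show ?case using \<open>\<And>\<alpha> \<beta>. _ \<Longrightarrow> replaceable \<alpha> \<beta>\<close> replaceable_sym replaceable_trans by meson
  qed
qed

lemma walk_equiv_ends:
  assumes "(\<alpha>, \<beta>) \<in> walk_equiv G"
  shows "hd \<alpha> = hd \<beta>" "last \<alpha> = last \<beta>"
  using walk_equiv_replaceable[OF assms] by (auto simp: replaceable_def)

lemma walk_equiv_append:
  assumes "(\<alpha>, \<beta>) \<in> walk_equiv G" "walk G (xs @ \<alpha> @ ys)"
  shows "(xs @ \<alpha> @ ys, xs @ \<beta> @ ys) \<in> walk_equiv G"
  using walk_equiv_replaceable[OF assms(1)] assms(2) walk_equiv_refl by (auto simp: replaceable_def)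

text \<open>One factor is replaced at a time. For the second, the concatenation is rewritten as
  \<open>butlast \<alpha>' @ \<beta>\<close>, so that \<beta> appears whole.\<close>

lemma walk_equiv_concat:
  assumes \<alpha>: "(\<alpha>, \<alpha>') \<in> walk_equiv G" and \<beta>: "(\<beta>, \<beta>') \<in> walk_equiv G" and "last \<alpha> = hd \<beta>"
  shows "(\<alpha> @ tl \<beta>, \<alpha>' @ tl \<beta>') \<in> walk_equiv G"
proof -
  note w = walk_equiv_walk[OF \<alpha>] walk_equiv_walk[OF \<beta>]
  note e = walk_equiv_ends[OF \<alpha>] walk_equiv_ends[OF \<beta>]
  note ne = w[THEN walk_nonempty]
  have "(\<alpha> @ tl \<beta>, \<alpha>' @ tl \<beta>) \<in> walk_equiv G"
    using walk_equiv_append[OF \<alpha>, of "[]" "tl \<beta>"] walk_concat[OF w(1,3)] assms(3) by simp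
  also have "(\<alpha>' @ tl \<beta>, \<alpha>' @ tl \<beta>') \<in> walk_equiv G"
    using walk_equiv_append[OF \<beta>, of "butlast \<alpha>'" "[]"] walk_concat[OF w(2,3)] assms(3) e
      butlast_append_concat[OF ne(2,3)] butlast_append_concat[OF ne(2,4)] by simp
  finally show ?thesis .
qed

text \<open>By induction the inner part of the there-and-back walk contracts to the vertex
  \<open>hd \<alpha>\<close>, leaving the backtrack \<open>x\<close>, \<open>hd \<alpha>\<close>,
  \<open>x\<close> to be deleted.\<close>

lemma walk_equiv_concat_rev:
  "walk G \<alpha> \<Longrightarrow> (\<alpha> @ tl (rev \<alpha>), [hd \<alpha>]) \<in> walk_equiv G"
proof (induction \<alpha>)
  case (Cons x \<alpha>)
  show ?case
  proof (cases "\<alpha> = []")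
    case True
    then show ?thesis using Cons walk_equiv_refl by simp
  next
    case False
    have w: "walk G \<alpha>" "(x, hd \<alpha>) \<in> edges G" "x \<in> verts G"
      using Cons.prems False by (auto simp: walk_Cons)
    have "walk G ((x # \<alpha>) @ tl (rev (x # \<alpha>)))"
      by (rule walk_concat) (use Cons.prems walk_rev[OF Cons.prems] False in \<open>auto simp: hd_rev\<close>)
    then have "walk G ([x] @ (\<alpha> @ tl (rev \<alpha>)) @ [x])" using False by (simp add: tl_append2)
    then have "([x] @ (\<alpha> @ tl (rev \<alpha>)) @ [x], [x] @ [hd \<alpha>] @ [x]) \<in> walk_equiv G"
      by (rule walk_equiv_append[OF Cons.IH[OF w(1)]])
    also have "([x] @ [hd \<alpha>] @ [x], [x]) \<in> walk_equiv G"
      using walk_equiv_backtrack[of "[]" x "[]" "hd \<alpha>"] w by (simp add: walk_singleton)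
    finally show ?thesis using False by (simp add: tl_append2)
  qed
qed (simp add: walk_def)

section \<open>The fundamental groupoid\<close>

abbreviation walk_class :: "'a list \<Rightarrow> 'a list set" where
  "walk_class \<alpha> \<equiv> walk_equiv G `` {\<alpha>}"

lemma walk_class_eqI: "(\<alpha>, \<beta>) \<in> walk_equiv G \<Longrightarrow> walk_class \<alpha> = walk_class \<beta>"
  by (rule equiv_class_eq[OF equiv_walk_equiv])

lemma Hom_E:
  assumes "a \<in> Hom (fundamental_groupoid G) x y"
  obtains \<alpha> where "walk G \<alpha>" "hd \<alpha> = x" "last \<alpha> = y" "a = walk_class \<alpha>"
  using assms by (auto simp: fundamental_groupoid_def walks_between_def elim: quotientE)

lemma walk_class_in_Hom:
  "walk G \<alpha> \<Longrightarrow> walk_class \<alpha> \<in> Hom (fundamental_groupoid G) (hd \<alpha>) (last \<alpha>)"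
  by (auto simp: fundamental_groupoid_def walks_between_def intro!: quotientI)

lemma Comp_walk_class:
  assumes "walk G \<alpha>" "walk G \<beta>" "last \<alpha> = hd \<beta>"
  shows "Comp (fundamental_groupoid G) (walk_class \<beta>) (walk_class \<alpha>) = walk_class (\<alpha> @ tl \<beta>)"
proof -
  have "walk_class (\<alpha>' @ tl \<beta>') = walk_class (\<alpha> @ tl \<beta>)"
    if "\<alpha>' \<in> walk_class \<alpha>" "\<beta>' \<in> walk_class \<beta>" for \<alpha>' \<beta>'
    using that assms(3) by (intro walk_class_eqI[symmetric] walk_equiv_concat) auto
  \<comment> \<open>All members of the union coincide; it equals their common value because both
    index sets are inhabited.\<close>
  moreover have "\<alpha> \<in> walk_class \<alpha>" "\<beta> \<in> walk_class \<beta>" using assms walk_equiv_refl by auto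
  ultimately have "(\<Union>\<alpha>'\<in>walk_class \<alpha>. \<Union>\<beta>'\<in>walk_class \<beta>. walk_class (\<alpha>' @ tl \<beta>')) =
      walk_class (\<alpha> @ tl \<beta>)"
    by (smt (verit, best) UN_constant SUP_cong empty_iff)
  then show ?thesis by (simp add: fundamental_groupoid_def)
qed

lemma Obj_fundamental_groupoid: "Obj (fundamental_groupoid G) = verts G"
  and Id_fundamental_groupoid: "Id (fundamental_groupoid G) x = walk_class [x]"
  by (simp_all add: fundamental_groupoid_def)

lemma category_fundamental_groupoid: "category (fundamental_groupoid G)"
proof
  fix x y x' y' f
  assume f: "f \<in> Hom (fundamental_groupoid G) x y" "f \<in> Hom (fundamental_groupoid G) x' y'"
  obtain \<alpha> where \<alpha>: "walk G \<alpha>" "hd \<alpha> = x" "last \<alpha> = y" "f = walk_class \<alpha>"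
    using f(1) by (rule Hom_E)
  obtain \<beta> where \<beta>: "walk G \<beta>" "hd \<beta> = x'" "last \<beta> = y'" "f = walk_class \<beta>"
    using f(2) by (rule Hom_E)
  \<comment> \<open>Equal classes have equivalent representatives, and equivalent walks share both
    ends.\<close>
  have "(\<alpha>, \<beta>) \<in> walk_equiv G"
    using eq_equiv_class[OF _ equiv_walk_equiv, of \<alpha> \<beta>] \<alpha> \<beta> by simp
  then show "x = x' \<and> y = y'" using walk_equiv_ends \<alpha> \<beta> by blast
next
  fix x assume "x \<in> Obj (fundamental_groupoid G)"
  then show "Id (fundamental_groupoid G) x \<in> Hom (fundamental_groupoid G) x x"
    using walk_class_in_Hom[of "[x]"]
    by (simp add: Obj_fundamental_groupoid Id_fundamental_groupoid walk_singleton)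
next
  fix x y z f g
  assume f: "f \<in> Hom (fundamental_groupoid G) x y" and g: "g \<in> Hom (fundamental_groupoid G) y z"
  obtain \<alpha> where \<alpha>: "walk G \<alpha>" "hd \<alpha> = x" "last \<alpha> = y" "f = walk_class \<alpha>"
    using f by (rule Hom_E)
  obtain \<beta> where \<beta>: "walk G \<beta>" "hd \<beta> = y" "last \<beta> = z" "g = walk_class \<beta>"
    using g by (rule Hom_E)
  show "Comp (fundamental_groupoid G) g f \<in> Hom (fundamental_groupoid G) x z"
    using walk_class_in_Hom[OF walk_concat[of G \<alpha> \<beta>]] \<alpha> \<beta> hd_last_concat[of \<alpha> \<beta>]
    by (simp add: Comp_walk_class walk_nonempty)
next
  fix x y f
  assume "x \<in> Obj (fundamental_groupoid G)" "y \<in> Obj (fundamental_groupoid G)"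
    and f: "f \<in> Hom (fundamental_groupoid G) x y"
  then have xy: "walk G [x]" "walk G [y]" by (simp_all add: Obj_fundamental_groupoid walk_singleton)
  obtain \<alpha> where \<alpha>: "walk G \<alpha>" "hd \<alpha> = x" "last \<alpha> = y" "f = walk_class \<alpha>"
    using f by (rule Hom_E)
  \<comment> \<open>Both identity laws hold for the walks themselves:
    \<open>[x] @ tl \<alpha>\<close> and \<open>\<alpha> @ tl [y]\<close> are \<alpha>.\<close>
  then have "x # tl \<alpha> = \<alpha>" using walk_nonempty by (cases \<alpha>) auto
  then show "Comp (fundamental_groupoid G) f (Id (fundamental_groupoid G) x) = f"
    and "Comp (fundamental_groupoid G) (Id (fundamental_groupoid G) y) f = f"
    using \<alpha> xy by (simp_all add: Id_fundamental_groupoid Comp_walk_class)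
next
  fix w x y z f g h
  assume f: "f \<in> Hom (fundamental_groupoid G) w x" and g: "g \<in> Hom (fundamental_groupoid G) x y"
    and h: "h \<in> Hom (fundamental_groupoid G) y z"
  obtain \<alpha> where \<alpha>: "walk G \<alpha>" "hd \<alpha> = w" "last \<alpha> = x" "f = walk_class \<alpha>"
    using f by (rule Hom_E)
  obtain \<beta> where \<beta>: "walk G \<beta>" "hd \<beta> = x" "last \<beta> = y" "g = walk_class \<beta>"
    using g by (rule Hom_E)
  obtain \<gamma> where \<gamma>: "walk G \<gamma>" "hd \<gamma> = y" "last \<gamma> = z" "h = walk_class \<gamma>"
    using h by (rule Hom_E)
  \<comment> \<open>Since \<beta> is nonempty, both bracketings give the list
    \<open>\<alpha> @ tl \<beta> @ tl \<gamma>\<close>.\<close>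
  have "tl (\<beta> @ tl \<gamma>) = tl \<beta> @ tl \<gamma>" using walk_nonempty[OF \<beta>(1)] by simp
  then show "Comp (fundamental_groupoid G) (Comp (fundamental_groupoid G) h g) f =
      Comp (fundamental_groupoid G) h (Comp (fundamental_groupoid G) g f)"
    using \<alpha> \<beta> \<gamma> walk_concat[of G \<alpha> \<beta>] walk_concat[of G \<beta> \<gamma>]
      hd_last_concat[of \<alpha> \<beta>] hd_last_concat[of \<beta> \<gamma>]
    by (simp add: Comp_walk_class walk_nonempty)
qed

text \<open>The inverse is the class of the reversed walk; \<open>walk_equiv_concat_rev\<close> for
  \<alpha> and for \<open>rev \<alpha>\<close> gives the two composites.\<close>

lemma isomorphism_walk_class:
  assumes "walk G \<alpha>"
  shows "isomorphism (fundamental_groupoid G) (hd \<alpha>) (last \<alpha>) (walk_class \<alpha>)"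
proof -
  note r = walk_rev[OF assms]
  have "walk_class (rev \<alpha>) \<in> Hom (fundamental_groupoid G) (last \<alpha>) (hd \<alpha>)"
    using walk_class_in_Hom[OF r] by (simp add: hd_rev last_rev)
  moreover have "Comp (fundamental_groupoid G) (walk_class (rev \<alpha>)) (walk_class \<alpha>) = walk_class [hd \<alpha>]"
    using assms r walk_class_eqI[OF walk_equiv_concat_rev[OF assms]]
    by (simp add: Comp_walk_class hd_rev)
  moreover have "Comp (fundamental_groupoid G) (walk_class \<alpha>) (walk_class (rev \<alpha>)) = walk_class [last \<alpha>]"
    using assms r walk_class_eqI[OF walk_equiv_concat_rev[OF r]]
    by (simp add: Comp_walk_class hd_rev last_rev)
  ultimately show ?thesis
    unfolding isomorphism_def Id_fundamental_groupoid using walk_class_in_Hom[OF assms] by blast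
qed

end

section \<open>Induced functors and homotopies\<close>

locale graph_morphism = G: graph G + H: graph H
  for G :: "'a pre_graph" and H :: "'b pre_graph" +
  fixes \<phi> :: "'a \<Rightarrow> 'b"
  assumes hom: "\<phi> \<in> graph_hom G H"
begin

lemma hom_edge: "(u, v) \<in> edges G \<Longrightarrow> (\<phi> u, \<phi> v) \<in> edges H"
  using hom by (auto simp: graph_hom_def)

lemma hom_vert: "v \<in> verts G \<Longrightarrow> \<phi> v \<in> verts H"
  using hom by (auto simp: graph_hom_def)

lemma walk_map: "walk G \<gamma> \<Longrightarrow> walk H (map \<phi> \<gamma>)"
  unfolding walk_def by (auto simp: hom_edge hom_vert subset_iff)

lemma walks_between_map:
  "\<gamma> \<in> walks_between G x y \<Longrightarrow> map \<phi> \<gamma> \<in> walks_between H (\<phi> x) (\<phi> y)"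
  by (auto simp: walks_between_def walk_map walk_nonempty hd_map last_map)

lemma walk_adj_map: "walk_adj G \<alpha> \<beta> \<Longrightarrow> walk_adj H (map \<phi> \<alpha>) (map \<phi> \<beta>)"
  unfolding walk_adj_def by (auto simp: hom_edge)

text \<open>A morphism sends adjacent walks with common ends to such walks and extensions to
  extensions, hence generators into the equivalence on \<open>H\<close>.\<close>

lemma walk_equiv_map:
  assumes "(\<alpha>, \<beta>) \<in> walk_equiv G"
  shows "(map \<phi> \<alpha>, map \<phi> \<beta>) \<in> walk_equiv H"
proof -
  let ?R = "\<lambda>\<alpha> \<beta>. (\<exists>x y. homotopic_rel_endpoints G x y \<alpha> \<beta>) \<or> walk_extend G \<alpha> \<beta>"
  have step: "(map \<phi> \<alpha>, map \<phi> \<beta>) \<in> walk_equiv H" if "?R \<alpha> \<beta>" for \<alpha> \<beta>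
    using that
  proof
    assume "\<exists>x y. homotopic_rel_endpoints G x y \<alpha> \<beta>"
    then obtain x y where \<alpha>: "\<alpha> \<in> walks_between G x y" and
      "(\<lambda>\<alpha> \<beta>. \<alpha> \<in> walks_between G x y \<and> \<beta> \<in> walks_between G x y \<and> walk_adj G \<alpha> \<beta>)\<^sup>*\<^sup>* \<alpha> \<beta>"
      unfolding homotopic_rel_endpoints_def by blast
    from this(2) show ?thesis
    proof induction
      case base
      \<comment> \<open>The empty chain says nothing about \<alpha>; that it is a walk comes from
        the membership kept aside.\<close>
      show ?case using walks_between_map[OF \<alpha>] by (simp add: walks_between_def H.walk_equiv_refl)
    next
      case (step \<beta> \<gamma>)
      have "(map \<phi> \<beta>, map \<phi> \<gamma>) \<in> walk_equiv H"
        using walks_between_map[of \<beta> x y] walks_between_map[of \<gamma> x y] step.hyps walk_adj_map[of \<beta> \<gamma>]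
        by (intro H.walk_equiv_adj) (auto simp: walks_between_def)
      with step.IH show ?case by (rule H.walk_equiv_trans)
    qed
  next
    assume "walk_extend G \<alpha> \<beta>"
    then have "walk_extend H (map \<phi> \<alpha>) (map \<phi> \<beta>)"
    proof cases
      case (extend \<gamma> u v)
      then show ?thesis
        using walk_extend.extend[of H "map \<phi> \<gamma>" "\<phi> u" "\<phi> v"] walk_map[of \<alpha>] by simp
    next
      case (extend_trivial v w)
      then show ?thesis
        using walk_extend.extend_trivial[of H "\<phi> v" "\<phi> w"] walk_map[of \<alpha>] hom_edge by simp
    qed
    then show ?thesis by (rule H.walk_equiv_extend)
  qed
  have "equivclp ?R \<alpha> \<beta>" "walk G \<alpha>" using assms by (simp_all add: walk_equiv_def)
  then show ?thesis
  proof (induction rule: equivclp_induct)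
    case base
    then show ?case by (simp add: walk_map H.walk_equiv_refl)
  next
    case (step y z)
    then show ?case
      using \<open>\<And>\<alpha> \<beta>. ?R \<alpha> \<beta> \<Longrightarrow> _\<close> H.walk_equiv_sym H.walk_equiv_trans by meson
  qed
qed

lemma on_arr_walk_class:
  assumes "walk G \<alpha>"
  shows "on_arr (induced_functor H \<phi>) (G.walk_class \<alpha>) = H.walk_class (map \<phi> \<alpha>)"
proof -
  have "H.walk_class (map \<phi> \<alpha>') = H.walk_class (map \<phi> \<alpha>)" if "\<alpha>' \<in> G.walk_class \<alpha>" for \<alpha>'
    using that by (intro H.walk_class_eqI[symmetric] walk_equiv_map) auto
  moreover have "\<alpha> \<in> G.walk_class \<alpha>" using assms G.walk_equiv_refl by auto
  ultimately have "(\<Union>\<alpha>'\<in>G.walk_class \<alpha>. H.walk_class (map \<phi> \<alpha>')) = H.walk_class (map \<phi> \<alpha>)"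
    by (smt (verit, best) UN_constant SUP_cong empty_iff)
  then show ?thesis by (simp add: induced_functor_def)
qed

lemma on_obj_induced_functor: "on_obj (induced_functor H \<phi>) = \<phi>"
  by (simp add: induced_functor_def)

text \<open>\<open>map \<phi>\<close> commutes with concatenation and preserves one-vertex walks, so
  the functor laws hold on representatives.\<close>

lemma category_functor_induced:
  "category_functor (fundamental_groupoid G) (fundamental_groupoid H) (induced_functor H \<phi>)"
proof (intro category_functor.intro category_functor_axioms.intro
    G.category_fundamental_groupoid H.category_fundamental_groupoid)
  fix x assume "x \<in> Obj (fundamental_groupoid G)"
  then show "on_obj (induced_functor H \<phi>) x \<in> Obj (fundamental_groupoid H)"
    and "on_arr (induced_functor H \<phi>) (Id (fundamental_groupoid G) x) =
      Id (fundamental_groupoid H) (on_obj (induced_functor H \<phi>) x)"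
    by (simp_all add: G.Obj_fundamental_groupoid H.Obj_fundamental_groupoid hom_vert
        on_obj_induced_functor G.Id_fundamental_groupoid H.Id_fundamental_groupoid
        on_arr_walk_class walk_singleton)
next
  fix x y f
  assume f: "f \<in> Hom (fundamental_groupoid G) x y"
  obtain \<alpha> where \<alpha>: "walk G \<alpha>" "hd \<alpha> = x" "last \<alpha> = y" "f = G.walk_class \<alpha>"
    using f by (rule G.Hom_E)
  then show "on_arr (induced_functor H \<phi>) f \<in> Hom (fundamental_groupoid H)
      (on_obj (induced_functor H \<phi>) x) (on_obj (induced_functor H \<phi>) y)"
    using H.walk_class_in_Hom[OF walk_map[OF \<alpha>(1)]]
    by (simp add: on_arr_walk_class on_obj_induced_functor hd_map last_map walk_nonempty)
next
  fix x y z f g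
  assume f: "f \<in> Hom (fundamental_groupoid G) x y" and g: "g \<in> Hom (fundamental_groupoid G) y z"
  obtain \<alpha> where \<alpha>: "walk G \<alpha>" "hd \<alpha> = x" "last \<alpha> = y" "f = G.walk_class \<alpha>"
    using f by (rule G.Hom_E)
  obtain \<beta> where \<beta>: "walk G \<beta>" "hd \<beta> = y" "last \<beta> = z" "g = G.walk_class \<beta>"
    using g by (rule G.Hom_E)
  show "on_arr (induced_functor H \<phi>) (Comp (fundamental_groupoid G) g f) =
      Comp (fundamental_groupoid H) (on_arr (induced_functor H \<phi>) g) (on_arr (induced_functor H \<phi>) f)"
    using \<alpha> \<beta> walk_concat[of G \<alpha> \<beta>] walk_map
    by (simp add: G.Comp_walk_class H.Comp_walk_class on_arr_walk_class hd_map last_map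
        walk_nonempty map_tl)
qed

end

section \<open>Natural families of walks along a homotopy\<close>

text \<open>Representatives of the components of a natural transformation, with the naturality
  square required on single edges only, as every walk is a concatenation of edges. Its sides are
  \<open>p x\<close> followed by the \<psi>-edge and the \<phi>-edge followed by
  \<open>p y\<close>.\<close>

definition natural_walks ::
    "'a pre_graph \<Rightarrow> 'b pre_graph \<Rightarrow> ('a \<Rightarrow> 'b) \<Rightarrow> ('a \<Rightarrow> 'b) \<Rightarrow> ('a \<Rightarrow> 'b list) \<Rightarrow> bool" where
  "natural_walks G H \<phi> \<psi> p \<longleftrightarrow>
     (\<forall>x \<in> verts G. p x \<in> walks_between H (\<phi> x) (\<psi> x)) \<and>
     (\<forall>(x, y) \<in> edges G. (p x @ [\<psi> y], \<phi> x # p y) \<in> walk_equiv H)"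

context
  fixes G :: "'a pre_graph" and H :: "'b pre_graph"
  assumes G: "graph G" and H: "graph H"
begin

interpretation G: graph G by (rule G)
interpretation H: graph H by (rule H)

lemma natural_walks_refl:
  assumes "\<phi> \<in> graph_hom G H"
  shows "natural_walks G H \<phi> \<phi> (\<lambda>x. [\<phi> x])"
proof -
  interpret graph_morphism G H \<phi> by unfold_locales (rule assms)
  show ?thesis
    by (auto simp: natural_walks_def walks_between_def walk_singleton hom_vert
        intro!: H.walk_equiv_refl)
      (auto simp: walk_Cons walk_singleton hom_edge hom_vert dest: G.edge_verts)
qed

text \<open>Vertical pasting: the square of \<open>q\<close> is applied behind \<open>p x\<close>,
  then the square of \<open>p\<close> in front of \<open>q y\<close>.\<close>

lemma natural_walks_trans:
  assumes p: "natural_walks G H \<phi> \<chi> p" and q: "natural_walks G H \<chi> \<psi> q"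
  shows "natural_walks G H \<phi> \<psi> (\<lambda>x. p x @ tl (q x))"
proof -
  have wp: "walk H (p x)" "hd (p x) = \<phi> x" "last (p x) = \<chi> x" "p x \<noteq> []"
    and wq: "walk H (q x)" "hd (q x) = \<chi> x" "last (q x) = \<psi> x" "q x \<noteq> []"
    if "x \<in> verts G" for x
    using p q that by (auto simp: natural_walks_def walks_between_def walk_nonempty)
  have "p x @ tl (q x) \<in> walks_between H (\<phi> x) (\<psi> x)" if "x \<in> verts G" for x
    using wp[OF that] wq[OF that] hd_last_concat[of "p x" "q x"]
    by (auto simp: walks_between_def intro: walk_concat)
  moreover have "((p x @ tl (q x)) @ [\<psi> y], \<phi> x # p y @ tl (q y)) \<in> walk_equiv H"
    if xy: "(x, y) \<in> edges G" for x y
  proof -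
    have x: "x \<in> verts G" and y: "y \<in> verts G" using G.edge_verts[OF xy] by auto
    have sp: "(p x @ [\<chi> y], \<phi> x # p y) \<in> walk_equiv H"
      and sq: "(q x @ [\<psi> y], \<chi> x # q y) \<in> walk_equiv H"
      using p q xy by (auto simp: natural_walks_def)
    have "(p x @ tl (q x @ [\<psi> y]), p x @ tl (\<chi> x # q y)) \<in> walk_equiv H"
      by (rule H.walk_equiv_concat[OF H.walk_equiv_refl sq]) (use wp[OF x] wq[OF x] in auto)
    \<comment> \<open>\<open>q y\<close> starts at \<open>\<chi> y\<close>, which is moved into the
      first factor to expose the square of \<open>p\<close>.\<close>
    also have "p x @ tl (\<chi> x # q y) = (p x @ [\<chi> y]) @ tl (q y)"
      using wq[OF y] by (cases "q y") auto
    also have "((p x @ [\<chi> y]) @ tl (q y), (\<phi> x # p y) @ tl (q y)) \<in> walk_equiv H"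
      by (rule H.walk_equiv_concat[OF sp H.walk_equiv_refl]) (use wq[OF y] in auto)
    finally show ?thesis using wq[OF x] by simp
  qed
  ultimately show ?thesis by (auto simp: natural_walks_def)
qed

lemma natural_walks_adjacent:
  assumes "\<nexists>v. isolated G v" "\<phi> \<in> graph_hom G H" "\<psi> \<in> graph_hom G H"
    and "(\<phi>, \<psi>) \<in> edges (exp_graph H G)"
  shows "\<exists>p. natural_walks G H \<phi> \<psi> p"
proof -
  interpret \<phi>: graph_morphism G H \<phi> by unfold_locales (rule assms)
  interpret \<psi>: graph_morphism G H \<psi> by unfold_locales (rule assms)
  have e: "(\<phi> u, \<psi> v) \<in> edges H" if "(u, v) \<in> edges G" for u v
    using assms(4) that by (auto simp: exp_graph_def)
  \<comment> \<open>The chosen neighbour exists because \<open>x\<close> is not isolated.\<close>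
  define n where "n x = (SOME w. (x, w) \<in> edges G)" for x
  have n: "(x, n x) \<in> edges G" "(n x, x) \<in> edges G" if "x \<in> verts G" for x
  proof -
    show "(x, n x) \<in> edges G"
      using assms(1) that unfolding n_def isolated_def by (metis someI_ex)
    then show "(n x, x) \<in> edges G" by (rule G.edge_sym)
  qed
  define p where "p x = [\<phi> x, \<phi> (n x), \<psi> x]" for x
  have w: "walk H (p x)" if "x \<in> verts G" for x
    using n[OF that] that G.edge_verts[OF n(1)[OF that]]
    by (auto simp: p_def walk_Cons walk_singleton \<phi>.hom_edge \<phi>.hom_vert \<psi>.hom_vert e)
  have "(p x @ [\<psi> y], \<phi> x # p y) \<in> walk_equiv H" if xy: "(x, y) \<in> edges G" for x y
  proof -
    have x: "x \<in> verts G" and y: "y \<in> verts G" using G.edge_verts[OF xy] by auto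
    note yx = G.edge_sym[OF xy]
    have "walk H (p x @ [\<psi> y])"
      using w[OF x] y \<psi>.hom_edge[OF xy] walk_append[of "p x" "[\<psi> y]" H]
      by (simp add: p_def walk_singleton \<psi>.hom_vert del: append.simps)
    \<comment> \<open>\<open>\<phi> (n x)\<close> is replaced by \<open>\<phi> y\<close>; its edge
      to \<open>\<psi> x\<close> is the adjacency of \<phi> and \<psi> on the reversed edge from
      \<open>y\<close> to \<open>x\<close>.\<close>
    then have "(p x @ [\<psi> y], [\<phi> x, \<phi> y, \<psi> x, \<psi> y]) \<in> walk_equiv H"
      using H.walk_equiv_replace_vertex[of "[]" "\<phi> x" "\<phi> (n x)" "\<psi> x" "[\<psi> y]" "\<phi> y"]
        \<phi>.hom_edge[OF xy] e[OF yx] by (simp add: p_def)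
    \<comment> \<open>\<open>\<psi> x\<close> is replaced by \<open>\<phi> (n y)\<close>, adjacent
      to \<open>\<phi> y\<close> by the morphism \<phi> and to \<open>\<psi> y\<close> by the
      adjacency of \<phi> and \<psi>.\<close>
    also have "([\<phi> x, \<phi> y, \<psi> x, \<psi> y], \<phi> x # p y) \<in> walk_equiv H"
      using H.walk_equiv_replace_vertex[of "[\<phi> x]" "\<phi> y" "\<psi> x" "\<psi> y" "[]" "\<phi> (n y)"]
        H.walk_equiv_walk(2)[OF calculation] \<phi>.hom_edge[OF n(1)[OF y]] e[OF n(2)[OF y]]
      by (simp add: p_def)
    finally show ?thesis .
  qed
  then have "natural_walks G H \<phi> \<psi> p"
    using w by (auto simp: natural_walks_def walks_between_def) (simp_all add: p_def)
  then show ?thesis by blast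
qed

lemma homotopic_natural_walks:
  assumes "\<nexists>v. isolated G v" "homotopic G H \<phi> \<psi>"
  shows "\<exists>p. natural_walks G H \<phi> \<psi> p"
proof -
  have "(\<lambda>f g. f \<in> graph_hom G H \<and> g \<in> graph_hom G H \<and> (f, g) \<in> edges (exp_graph H G))\<^sup>*\<^sup>* \<phi> \<psi>"
    and \<phi>: "\<phi> \<in> graph_hom G H"
    using assms(2) by (auto simp: homotopic_def)
  then show ?thesis
  proof (induction rule: rtranclp_induct)
    case base
    show ?case using natural_walks_refl[OF \<phi>] by blast
  next
    case (step \<chi> \<psi>)
    then show ?case using natural_walks_adjacent[OF assms(1), of \<chi> \<psi>] natural_walks_trans by blast
  qed
qed

text \<open>Horizontal pasting of the edge squares, by induction on the walk.\<close>

lemma natural_walks_square: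
  assumes "graph_morphism G H \<phi>" "graph_morphism G H \<psi>" "natural_walks G H \<phi> \<psi> p" "walk G \<gamma>"
  shows "(p (hd \<gamma>) @ tl (map \<psi> \<gamma>), map \<phi> \<gamma> @ tl (p (last \<gamma>))) \<in> walk_equiv H"
  using assms(4)
proof (induction \<gamma>)
  case (Cons x \<gamma>)
  interpret \<phi>: graph_morphism G H \<phi> by (rule assms)
  interpret \<psi>: graph_morphism G H \<psi> by (rule assms)
  have wp: "walk H (p x)" "hd (p x) = \<phi> x" "last (p x) = \<psi> x" "p x \<noteq> []"
    if "x \<in> verts G" for x
    using assms(3) that by (auto simp: natural_walks_def walks_between_def walk_nonempty)
  show ?case
  proof (cases \<gamma>)
    case Nil
    then have x: "x \<in> verts G" using Cons.prems by (simp add: walk_singleton)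
    then have "\<phi> x # tl (p x) = p x" using wp[OF x] by (cases "p x") auto
    then show ?thesis using Nil wp[OF x] by (simp add: H.walk_equiv_refl)
  next
    case (Cons y \<gamma>')
    have w: "walk G \<gamma>" and xy: "(x, y) \<in> edges G"
      using Cons.prems Cons by (auto simp: walk_Cons)
    have x: "x \<in> verts G" and y: "y \<in> verts G" using G.edge_verts[OF xy] by auto
    have "(p x @ [\<psi> y], \<phi> x # p y) \<in> walk_equiv H"
      using assms(3) xy by (auto simp: natural_walks_def)
    \<comment> \<open>The square of the first edge carries \<open>p\<close> from \<open>x\<close> to
      \<open>y\<close>; the induction hypothesis, behind the prefix \<open>[\<phi> x]\<close>,
      carries it to the end.\<close>
    then have "((p x @ [\<psi> y]) @ tl (map \<psi> \<gamma>), (\<phi> x # p y) @ tl (map \<psi> \<gamma>)) \<in> walk_equiv H"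
      by (rule H.walk_equiv_concat) (use \<psi>.walk_map[OF w] Cons in \<open>auto intro: H.walk_equiv_refl\<close>)
    also have "([\<phi> x] @ (p y @ tl (map \<psi> \<gamma>)) @ [], [\<phi> x] @ (map \<phi> \<gamma> @ tl (p (last \<gamma>))) @ [])
        \<in> walk_equiv H"
      using H.walk_equiv_append[OF Cons.IH[OF w], of "[\<phi> x]" "[]"]
        H.walk_equiv_walk(2)[OF calculation] Cons by simp
    then have "((\<phi> x # p y) @ tl (map \<psi> \<gamma>), \<phi> x # map \<phi> \<gamma> @ tl (p (last \<gamma>))) \<in> walk_equiv H"
      by simp
    finally show ?thesis using Cons by simp
  qed
qed (simp add: walk_def)

text \<open>Naturality at an arrow is the square for any walk representing it, and the components
  are invertible because every class of walks is.\<close>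

lemma natural_isomorphism_natural_walks:
  assumes "graph_morphism G H \<phi>" "graph_morphism G H \<psi>" "natural_walks G H \<phi> \<psi> p"
  shows "natural_isomorphism (fundamental_groupoid G) (fundamental_groupoid H)
     (induced_functor H \<phi>) (induced_functor H \<psi>) (\<lambda>x. H.walk_class (p x))"
proof -
  interpret \<phi>: graph_morphism G H \<phi> by (rule assms)
  interpret \<psi>: graph_morphism G H \<psi> by (rule assms)
  have wp: "walk H (p x)" "hd (p x) = \<phi> x" "last (p x) = \<psi> x" "p x \<noteq> []"
    if "x \<in> verts G" for x
    using assms(3) that by (auto simp: natural_walks_def walks_between_def walk_nonempty)
  show ?thesis
  proof (intro natural_isomorphism.intro natural_transformation.intro
      natural_transformation_axioms.intro natural_isomorphism_axioms.intro
      \<phi>.category_functor_induced \<psi>.category_functor_induced)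
    fix x assume "x \<in> Obj (fundamental_groupoid G)"
    then have x: "x \<in> verts G" by (simp add: G.Obj_fundamental_groupoid)
    show "H.walk_class (p x) \<in> Hom (fundamental_groupoid H)
        (on_obj (induced_functor H \<phi>) x) (on_obj (induced_functor H \<psi>) x)"
      and "isomorphism (fundamental_groupoid H) (on_obj (induced_functor H \<phi>) x)
        (on_obj (induced_functor H \<psi>) x) (H.walk_class (p x))"
      using H.walk_class_in_Hom[OF wp(1)[OF x]] H.isomorphism_walk_class[OF wp(1)[OF x]] wp[OF x]
      by (simp_all add: \<phi>.on_obj_induced_functor \<psi>.on_obj_induced_functor)
  next
    fix x y f
    assume "x \<in> Obj (fundamental_groupoid G)" "y \<in> Obj (fundamental_groupoid G)"
      and f: "f \<in> Hom (fundamental_groupoid G) x y"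
    then have x: "x \<in> verts G" and y: "y \<in> verts G" by (simp_all add: G.Obj_fundamental_groupoid)
    obtain \<gamma> where \<gamma>: "walk G \<gamma>" "hd \<gamma> = x" "last \<gamma> = y" "f = G.walk_class \<gamma>"
      using f by (rule G.Hom_E)
    note ne = walk_nonempty[OF \<gamma>(1)]
    show "Comp (fundamental_groupoid H) (H.walk_class (p y)) (on_arr (induced_functor H \<phi>) f) =
        Comp (fundamental_groupoid H) (on_arr (induced_functor H \<psi>) f) (H.walk_class (p x))"
      using \<gamma> wp[OF x] wp[OF y] ne \<phi>.walk_map[OF \<gamma>(1)] \<psi>.walk_map[OF \<gamma>(1)]
        H.walk_class_eqI[OF natural_walks_square[OF assms \<gamma>(1)]]
      by (simp add: \<phi>.on_arr_walk_class \<psi>.on_arr_walk_class H.Comp_walk_class hd_map last_map)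
  qed
qed

end

theorem theorem6p11:
  fixes G :: "'a pre_graph" and H :: "'b pre_graph" and \<phi> \<psi> :: "'a \<Rightarrow> 'b"
  assumes "graph G" and "graph H"
    and "\<nexists>v. isolated G v" and "\<nexists>v. isolated H v"
    and "\<phi> \<in> graph_hom G H" and "\<psi> \<in> graph_hom G H"
    and "homotopic G H \<phi> \<psi>"
  shows "\<exists>\<eta>. natural_isomorphism (fundamental_groupoid G) (fundamental_groupoid H)
                (induced_functor H \<phi>) (induced_functor H \<psi>) \<eta>"
proof -
  have "graph_morphism G H \<phi>" "graph_morphism G H \<psi>"
    using assms by (simp_all add: graph_morphism_def graph_morphism_axioms_def)
  moreover obtain p where "natural_walks G H \<phi> \<psi> p"
    using homotopic_natural_walks[OF assms(1-3,7)] by blast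
  ultimately show ?thesis
    using natural_isomorphism_natural_walks[OF assms(1,2)] by blast
qed

end
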